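(* Let $(K,|\cdot|)$ be a non-Archimedean valued field, $k$ its residue field and $D$ its ring of integers. Assume that $\operatorname{char}K=0$ and $\operatorname{char}k>0$. Let $n\ge2$, $\hat x=(\hat x_1,\dots,\hat x_n)\in K^n$, $x=(x_1,\dots,x_n)\in K^n$, $(x_1,x_2)\ne(\hat x_1,\hat x_2)$, $0<r<\|(x_1,x_2)-(\hat x_1,\hat x_2)\|$ and $\varepsilon\in(0,1]$. Then there exists a free subgroup $F'\le\mathrm{SA}(n,D,\varepsilon)$ of infinite rank acting without nontrivial fixed points on $K^n\setminus(\{(\hat x_1,\hat x_2)\}\times K^{n-2})$, on the balls $B[x,r]$ and $B(x,r)$, and on the sphere $S[x,r]$. Moreover, $F'$ can be chosen so that $F'\le\mathrm{SA}(n,\mathbb Z)$ if $(\hat x_1,\hat x_2)\in\mathbb Z^2$, and $F'\le\mathrm{SL}(n,\mathbb Z,\varepsilon)$ if $(\hat x_1,\hat x_2)=(0,0)$.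
   Context: A non-Archimedean valuation on a field $K$ is a function $|\cdot|:K\to[0,\infty)$ with $|x|=0\iff x=0$, $|xy|=|x||y|$, $|x+y|\le\max\{|x|,|y|\}$. $D=\{x\in K:|x|\le1\}$, $\mathfrak m=\{x:|x|<1\}$, and the residue field is $k=D/\mathfrak m$. As $\operatorname{char}K=0$, $\mathbb Z\subseteq D$. $K^n$ (and $K^2$) carries the norm $\|x\|=\max_i|x_i|$; $B[x,r]=\{y:\|y-x\|\le r\}$, $B(x,r)=\{y:\|y-x\|<r\}$, $S[x,r]=\{y:\|y-x\|=r\}$ in $K^n$. For a subring $R\subseteq D$ containing $1$ and $\varepsilon\in(0,1]$, $\mathrm{SL}(n,R,\varepsilon)$ is the group of matrices $[a_{ij}]\in\mathrm{SL}(n,R)$ with $|a_{ii}-1|<\varepsilon$ for all $i$ and $|a_{ij}|<\varepsilon$ for $i\ne j$. $\mathrm{SA}(n,D,\varepsilon)$ is the group of affine maps $K^n\to K^n$, $x\mapsto L(x)+\tau$, with $L\in\mathrm{SL}(n,D,\varepsilon)$, $\tau\in D^n$; $\mathrm{SA}(n,\mathbb Z)$ is the group of affine maps $x\mapsto L(x)+\tau$ with $L\in\mathrm{SL}(n,\mathbb Z)$, $\tau\in\mathbb Z^n$. Linear maps are affine maps with $\tau=0$. A group acts on a set without nontrivial fixed points if the set is invariant under the group and every point of it has trivial stabilizer. *)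

theory Defs
  imports
    "HOL-Algebra.Bij"
    "HOL-Algebra.Generated_Groups"
    "HOL-Algebra.Group_Action"
    "HOL-Algebra.QuotRing"
    "Jordan_Normal_Form.Determinant"
begin

locale nonarch_valuation =
  fixes v :: "'a::field \<Rightarrow> real"
  assumes val_nonneg: "0 \<le> v x"
    and val_eq_0_iff: "v x = 0 \<longleftrightarrow> x = 0"
    and val_mult: "v (x * y) = v x * v y"
    and val_ultra: "v (x + y) \<le> max (v x) (v y)"

definition int_ring :: "('a::field \<Rightarrow> real) \<Rightarrow> 'a set" where
  "int_ring v = {x. v x \<le> 1}"

definition max_ideal :: "('a::field \<Rightarrow> real) \<Rightarrow> 'a set" where
  "max_ideal v = {x. v x < 1}"

definition residue_field :: "('a::field \<Rightarrow> real) \<Rightarrow> 'a set ring" where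
  "residue_field v =
     \<lparr>carrier = int_ring v, monoid.mult = (*), one = 1, zero = 0, add = (+)\<rparr> Quot max_ideal v"

definition ring_char :: "('b, 'm) ring_scheme \<Rightarrow> nat" where
  "ring_char R =
     (if \<exists>m::nat. m > 0 \<and> add_pow R m \<one>\<^bsub>R\<^esub> = \<zero>\<^bsub>R\<^esub>
      then LEAST m::nat. m > 0 \<and> add_pow R m \<one>\<^bsub>R\<^esub> = \<zero>\<^bsub>R\<^esub>
      else 0)"

text \<open>The space \<open>K\<^sup>n\<close> is \<^term>\<open>carrier_vec n\<close>, with coordinates indexed from \<open>0\<close>. The maximum is
  only meaningful in positive dimension.\<close>

definition vnorm :: "('a::field \<Rightarrow> real) \<Rightarrow> 'a vec \<Rightarrow> real" where
  "vnorm v y = Max ((\<lambda>i. v (y $ i)) ` {..<dim_vec y})"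

definition vcball :: "('a::field \<Rightarrow> real) \<Rightarrow> 'a vec \<Rightarrow> real \<Rightarrow> 'a vec set" where
  "vcball v x r = {y \<in> carrier_vec (dim_vec x). vnorm v (y - x) \<le> r}"

definition vball :: "('a::field \<Rightarrow> real) \<Rightarrow> 'a vec \<Rightarrow> real \<Rightarrow> 'a vec set" where
  "vball v x r = {y \<in> carrier_vec (dim_vec x). vnorm v (y - x) < r}"

definition vsphere :: "('a::field \<Rightarrow> real) \<Rightarrow> 'a vec \<Rightarrow> real \<Rightarrow> 'a vec set" where
  "vsphere v x r = {y \<in> carrier_vec (dim_vec x). vnorm v (y - x) = r}"

definition vecs_over :: "nat \<Rightarrow> 'a set \<Rightarrow> 'a vec set" where
  "vecs_over n R = {y \<in> carrier_vec n. \<forall>i<n. y $ i \<in> R}"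

definition SL_mats :: "nat \<Rightarrow> 'a::field set \<Rightarrow> 'a mat set" where
  "SL_mats n R = {A \<in> carrier_mat n n. (\<forall>i<n. \<forall>j<n. A $$ (i, j) \<in> R) \<and> det A = 1}"

definition SL_eps_mats ::
  "('a::field \<Rightarrow> real) \<Rightarrow> nat \<Rightarrow> 'a set \<Rightarrow> real \<Rightarrow> 'a mat set" where
  "SL_eps_mats v n R \<epsilon> =
     {A \<in> SL_mats n R. (\<forall>i<n. v (A $$ (i, i) - 1) < \<epsilon>) \<and>
        (\<forall>i<n. \<forall>j<n. i \<noteq> j \<longrightarrow> v (A $$ (i, j)) < \<epsilon>)}"

text \<open>Maps \<open>K\<^sup>n \<rightarrow> K\<^sup>n\<close> are represented as extensional functions on \<^term>\<open>carrier_vec n\<close>, so that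
  bijective ones are elements of \<^term>\<open>BijGroup (carrier_vec n)\<close>, whose operation is composition.
  All the groups of affine maps below are regarded as subgroups of that group.\<close>

definition affine_map :: "nat \<Rightarrow> 'a::field mat \<Rightarrow> 'a vec \<Rightarrow> 'a vec \<Rightarrow> 'a vec" where
  "affine_map n A \<tau> = (\<lambda>y\<in>carrier_vec n. A *\<^sub>v y + \<tau>)"

definition SA_eps :: "('a::field \<Rightarrow> real) \<Rightarrow> nat \<Rightarrow> 'a set \<Rightarrow> real \<Rightarrow> ('a vec \<Rightarrow> 'a vec) set" where
  "SA_eps v n R \<epsilon> = {affine_map n A \<tau> | A \<tau>. A \<in> SL_eps_mats v n R \<epsilon> \<and> \<tau> \<in> vecs_over n R}"

definition SA :: "nat \<Rightarrow> 'a::field set \<Rightarrow> ('a vec \<Rightarrow> 'a vec) set" where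
  "SA n R = {affine_map n A \<tau> | A \<tau>. A \<in> SL_mats n R \<and> \<tau> \<in> vecs_over n R}"

definition SL_eps :: "('a::field \<Rightarrow> real) \<Rightarrow> nat \<Rightarrow> 'a set \<Rightarrow> real \<Rightarrow> ('a vec \<Rightarrow> 'a vec) set" where
  "SL_eps v n R \<epsilon> = {affine_map n A (0\<^sub>v n) | A. A \<in> SL_eps_mats v n R \<epsilon>}"

text \<open>A word is a list of signed letters: \<open>(g, True)\<close> stands for \<open>g\<close> and \<open>(g, False)\<close> for its
  inverse. It is reduced if no letter is adjacent to its formal inverse.\<close>

definition reduced_word :: "('g \<times> bool) list \<Rightarrow> bool" where
  "reduced_word w \<longleftrightarrow> successively (\<lambda>(g, b) (h, c). g = h \<longrightarrow> b = c) w"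

definition eval_word :: "('g, 'm) monoid_scheme \<Rightarrow> ('g \<times> bool) list \<Rightarrow> 'g" where
  "eval_word G w =
     foldr (\<lambda>(g, b) h. (if b then g else inv\<^bsub>G\<^esub> g) \<otimes>\<^bsub>G\<^esub> h) w \<one>\<^bsub>G\<^esub>"

definition free_basis :: "('g, 'm) monoid_scheme \<Rightarrow> 'g set \<Rightarrow> 'g set \<Rightarrow> bool" where
  "free_basis G F X \<longleftrightarrow> X \<subseteq> carrier G \<and> generate G X = F \<and>
     (\<forall>w. set w \<subseteq> X \<times> UNIV \<and> w \<noteq> [] \<and> reduced_word w \<longrightarrow> eval_word G w \<noteq> \<one>\<^bsub>G\<^esub>)"

definition free_subgroup_of_infinite_rank :: "'g set \<Rightarrow> ('g, 'm) monoid_scheme \<Rightarrow> bool" where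
  "free_subgroup_of_infinite_rank F G \<longleftrightarrow>
     subgroup F G \<and> (\<exists>X. infinite X \<and> free_basis G F X)"

text \<open>The set \<open>F\<close> is meant to be a subgroup of \<^term>\<open>BijGroup V\<close>, acting on \<open>V\<close> by evaluation.\<close>

definition acts_without_fixed_points :: "('x \<Rightarrow> 'x) set \<Rightarrow> 'x set \<Rightarrow> 'x set \<Rightarrow> bool" where
  "acts_without_fixed_points F V S \<longleftrightarrow>
     S \<subseteq> V \<and> (\<forall>f\<in>F. f ` S \<subseteq> S) \<and>
     (\<forall>y\<in>S. stabilizer ((BijGroup V)\<lparr>carrier := F\<rparr>) (\<lambda>f. f) y = {\<one>\<^bsub>BijGroup V\<^esub>})"

end

theory Submission
  imports Defs
begin

text \<open>If \<open>p\<close> is a positive integer with \<open>|p| < 1\<close>, then \<open>M = p\<^sup>k\<close> is arbitrarily small, so matrices in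
  \<open>SL(2, \<int>)\<close> congruent to \<open>1\<close> modulo \<open>M\<close>, acting on the first two coordinates around \<open>(xh\<^sub>0, xh\<^sub>1)\<close>, move
  every point of the given ball by less than \<open>r\<close>. It remains to find such matrices that freely
  generate a group whose nontrivial elements do not have the eigenvalue \<open>1\<close>. For \<open>n \<noteq> 0\<close> divisible by
  \<open>M\<close> and \<open>b = \<plusminus>5M\<close>, with the sign of \<open>n\<close>, the matrix with rows \<open>(1 + bn, b)\<close> and \<open>(n(2 + bn), 1 + bn)\<close>
  sends \<open>(p, q)\<close> to a vector with first entry \<open>p + b(q + np)\<close>, and replacing \<open>n\<close> by \<open>-n\<close> inverts it.
  Since \<open>|b| \<ge> 5\<close>, for every nonzero integer vector all but at most one of these matrices increase
  the absolute value of the first entry. This ping-pong condition gives freeness and excludes fixed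
  nonzero integer vectors, hence the eigenvalue \<open>1\<close>.\<close>

section \<open>Reduced words and ping-pong\<close>

definition letter_inv :: "'g \<times> bool \<Rightarrow> 'g \<times> bool" where
  "letter_inv s = (fst s, \<not> snd s)"

definition letter_val :: "('g, 'm) monoid_scheme \<Rightarrow> 'g \<times> bool \<Rightarrow> 'g" where
  "letter_val G s = (if snd s then fst s else inv\<^bsub>G\<^esub> (fst s))"

definition word_inv :: "('g \<times> bool) list \<Rightarrow> ('g \<times> bool) list" where
  "word_inv w = rev (map letter_inv w)"

lemma letter_inv_invol [simp]: "letter_inv (letter_inv s) = s"
  and letter_inv_neq [simp]: "letter_inv s \<noteq> s"
  by (auto simp: letter_inv_def prod_eq_iff)

lemma letter_inv_mem [simp]: "letter_inv s \<in> X \<times> UNIV \<longleftrightarrow> s \<in> X \<times> UNIV"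
  by (cases s) (auto simp: letter_inv_def)

lemma reduced_word_altdef: "reduced_word w \<longleftrightarrow> successively (\<lambda>s t. t \<noteq> letter_inv s) w"
  unfolding reduced_word_def letter_inv_def
  by (rule arg_cong[where f = "\<lambda>P. successively P w"]) (auto simp: fun_eq_iff)

lemma reduced_word_simps:
  "reduced_word []" "reduced_word [s]"
  "reduced_word (s # t # w) \<longleftrightarrow> t \<noteq> letter_inv s \<and> reduced_word (t # w)"
  by (simp_all add: reduced_word_altdef)

lemma reduced_word_append:
  "reduced_word (u @ w) \<Longrightarrow> reduced_word u \<and> reduced_word w"
  by (simp add: reduced_word_altdef successively_append_iff)

lemma reduced_word_inv: "reduced_word (word_inv w) \<longleftrightarrow> reduced_word w"
proof -
  have "(\<lambda>s t. letter_inv s \<noteq> t) = (\<lambda>s t. t \<noteq> letter_inv (s :: 'a \<times> bool))"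
    by (auto simp: fun_eq_iff)
  then show ?thesis
    unfolding reduced_word_altdef word_inv_def successively_rev successively_map letter_inv_invol
    by (rule arg_cong)
qed

lemma eval_word_simps [simp]:
  "eval_word G [] = \<one>\<^bsub>G\<^esub>"
  "eval_word G (s # w) = letter_val G s \<otimes>\<^bsub>G\<^esub> eval_word G w"
  by (simp_all add: eval_word_def letter_val_def split: prod.splits)

section \<open>Values of signed words in a group\<close>

context group
begin

lemma letter_val_closed: "X \<subseteq> carrier G \<Longrightarrow> s \<in> X \<times> UNIV \<Longrightarrow> letter_val G s \<in> carrier G"
  by (auto simp: letter_val_def)

lemma letter_val_inv:
  "X \<subseteq> carrier G \<Longrightarrow> s \<in> X \<times> UNIV \<Longrightarrow> letter_val G (letter_inv s) = inv (letter_val G s)"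
  by (auto simp: letter_val_def letter_inv_def)

lemma eval_word_closed:
  "X \<subseteq> carrier G \<Longrightarrow> set w \<subseteq> X \<times> UNIV \<Longrightarrow> eval_word G w \<in> carrier G"
  by (induction w) (use letter_val_closed in \<open>auto simp del: mem_Sigma_iff\<close>)

lemma eval_word_append:
  "X \<subseteq> carrier G \<Longrightarrow> set u \<subseteq> X \<times> UNIV \<Longrightarrow> set w \<subseteq> X \<times> UNIV \<Longrightarrow>
    eval_word G (u @ w) = eval_word G u \<otimes> eval_word G w"
  by (induction u) (use letter_val_closed eval_word_closed in \<open>simp_all add: m_assoc\<close>)

lemma eval_word_inv:
  assumes "X \<subseteq> carrier G" "set w \<subseteq> X \<times> UNIV"
  shows "eval_word G (word_inv w) = inv (eval_word G w)"
  using assms(2)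
proof (induction w)
  case (Cons s w)
  have sw: "s \<in> X \<times> UNIV" "set w \<subseteq> X \<times> UNIV" "set [letter_inv s] \<subseteq> X \<times> UNIV"
      "set (word_inv w) \<subseteq> X \<times> UNIV"
    using Cons.prems by (auto simp: word_inv_def letter_inv_def)
  have "eval_word G (word_inv (s # w)) = eval_word G (word_inv w @ [letter_inv s])"
    by (simp add: word_inv_def)
  also have "\<dots> = inv (eval_word G w) \<otimes> inv (letter_val G s)"
    using sw assms(1) Cons.IH letter_val_closed[OF assms(1)]
    by (subst eval_word_append[OF assms(1)]) (auto simp: letter_val_inv[OF assms(1)])
  finally show ?case
    using sw assms(1) by (simp add: inv_mult_group letter_val_closed eval_word_closed)
qed (simp add: word_inv_def)

text \<open>Induction on the word: a letter put in front of a reduced word either cancels against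
  its first letter or leaves it reduced.\<close>

lemma ex_reduced_word:
  assumes "X \<subseteq> carrier G" "set w \<subseteq> X \<times> UNIV"
  shows "\<exists>w'. set w' \<subseteq> X \<times> UNIV \<and> reduced_word w' \<and> eval_word G w' = eval_word G w"
  using assms(2)
proof (induction w)
  case (Cons s w)
  then obtain w' where w': "set w' \<subseteq> X \<times> UNIV" "reduced_word w'" "eval_word G w' = eval_word G w"
    by auto
  have s: "s \<in> X \<times> UNIV" using Cons.prems by simp
  show ?case
  proof (cases "\<exists>u. w' = letter_inv s # u")
    case True
    then obtain u where u: "w' = letter_inv s # u" by blast
    have "letter_val G s \<otimes> (inv (letter_val G s) \<otimes> eval_word G u) = eval_word G u"
      using assms(1) s u w'(1)
      by (simp add: m_assoc[symmetric] letter_val_closed eval_word_closed)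
    then have "eval_word G (s # w) = eval_word G u"
      using u s w'(3)[symmetric] assms(1) by (simp add: letter_val_inv)
    moreover have "reduced_word u"
      using w'(2) u by (cases u) (auto simp: reduced_word_simps)
    ultimately show ?thesis using u w'(1) by auto
  next
    case False
    then have "reduced_word (s # w')"
      using w'(2) by (cases w') (auto simp: reduced_word_simps)
    then show ?thesis using w' s by (intro exI[of _ "s # w'"]) auto
  qed
qed (auto simp: reduced_word_simps intro: exI[of _ "[]"])

lemma generate_eq_eval_word:
  assumes "X \<subseteq> carrier G" "g \<in> generate G X"
  shows "\<exists>w. set w \<subseteq> X \<times> UNIV \<and> reduced_word w \<and> g = eval_word G w"
proof -
  have "\<exists>w. set w \<subseteq> X \<times> UNIV \<and> g = eval_word G w"
    using assms(2)
  proof (induction rule: generate.induct)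
    case one
    show ?case by (intro exI[of _ "[]"]) simp
  next
    case (incl h)
    then show ?case using assms(1)
      by (intro exI[of _ "[(h, True)]"]) (auto simp: letter_val_def)
  next
    case (inv h)
    then show ?case using assms(1)
      by (intro exI[of _ "[(h, False)]"]) (auto simp: letter_val_def)
  next
    case (eng g h)
    then obtain u w where "set u \<subseteq> X \<times> UNIV" "g = eval_word G u"
        "set w \<subseteq> X \<times> UNIV" "h = eval_word G w"
      by blast
    then show ?case
      by (intro exI[of _ "u @ w"]) (auto simp: eval_word_append[OF assms(1)])
  qed
  then show ?thesis using ex_reduced_word[OF assms(1)] by metis
qed

end

text \<open>A form of the ping-pong lemma: if every point of \<^term>\<open>Y\<close> is moved up by all letters but at
  most one, then along a reduced word the height starts to increase strictly as soon as it has
  increased once. A fixed point of a word or of its inverse is therefore excluded, unless the word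
  is not cyclically reduced, in which case it can be shortened by conjugation.\<close>

locale expanding_action = group_action +
  fixes X :: "'a set" and Y :: "'b set" and N :: "'b \<Rightarrow> 'c::linorder"
  assumes X_closed: "X \<subseteq> carrier G" and Y_sub: "Y \<subseteq> E"
    and Y_inv: "s \<in> X \<times> UNIV \<Longrightarrow> y \<in> Y \<Longrightarrow> \<phi> (letter_val G s) y \<in> Y"
    and expand: "s \<in> X \<times> UNIV \<Longrightarrow> t \<in> X \<times> UNIV \<Longrightarrow> s \<noteq> t \<Longrightarrow> y \<in> Y \<Longrightarrow>
      N (\<phi> (letter_val G s) y) \<le> N y \<Longrightarrow> N y < N (\<phi> (letter_val G t) y)"
begin

sublocale group G
  using group_hom group_hom.axioms(1) by auto

lemma act_one: "y \<in> Y \<Longrightarrow> \<phi> \<one> y = y"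
  using id_eq_one Y_sub by (metis restrict_apply' subsetD)

lemma act_Cons:
  "set (s # w) \<subseteq> X \<times> UNIV \<Longrightarrow> y \<in> Y \<Longrightarrow>
    \<phi> (eval_word G (s # w)) y = \<phi> (letter_val G s) (\<phi> (eval_word G w) y)"
  using Y_sub by (subst eval_word_simps, subst composition_rule)
    (auto simp: letter_val_closed[OF X_closed] eval_word_closed[OF X_closed])

lemma act_closed: "set w \<subseteq> X \<times> UNIV \<Longrightarrow> y \<in> Y \<Longrightarrow> \<phi> (eval_word G w) y \<in> Y"
proof (induction w)
  case (Cons s w)
  then show ?case using Y_inv[of s] by (subst act_Cons) auto
qed (simp add: act_one)

lemma act_letter_inv:
  assumes "s \<in> X \<times> UNIV" "y \<in> Y"
  shows "\<phi> (letter_val G (letter_inv s)) (\<phi> (letter_val G s) y) = y"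
  using assms Y_sub orbit_sym_aux[of "letter_val G s" y]
  by (auto simp: letter_val_inv[OF X_closed] letter_val_closed[OF X_closed])

text \<open>The second conjunct carries the induction: if \<open>t\<close> has just raised the
  height, then \<open>letter_inv t\<close> lowers it again, so by \<open>expand\<close> every other
  letter raises it, and in a reduced word the next letter is another one. Words act from their right
  end, whence the assumption on \<open>last w\<close>.\<close>

lemma reduced_word_expands:
  assumes "w \<noteq> []" "set w \<subseteq> X \<times> UNIV" "reduced_word w" "y \<in> Y"
    and "N y < N (\<phi> (letter_val G (last w)) y)"
  shows "N y < N (\<phi> (eval_word G w) y) \<and> N (\<phi> (eval_word G (tl w)) y) < N (\<phi> (eval_word G w) y)"
  using assms
proof (induction w rule: induct_list012)
  case (2 s)
  then show ?case
    using letter_val_closed[OF X_closed, of s] by (simp add: act_one)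
next
  case (3 s t w)
  let ?z = "\<phi> (eval_word G (t # w)) y"
  have st: "s \<in> X \<times> UNIV" "t \<in> X \<times> UNIV" "set w \<subseteq> X \<times> UNIV" "set (t # w) \<subseteq> X \<times> UNIV"
    using "3.prems" by auto
  have IH: "N y < N ?z" "N (\<phi> (eval_word G w) y) < N ?z"
    using "3.IH"(2) "3.prems" by (auto simp: reduced_word_simps)
  have z: "?z \<in> Y" using act_closed[OF st(4)] "3.prems" by blast
  have "\<phi> (letter_val G (letter_inv t)) ?z = \<phi> (eval_word G w) y"
    using act_closed[OF st(3)] act_letter_inv[OF st(2)] "3.prems" st(4) by (simp only: act_Cons)
  moreover have "letter_inv t \<noteq> s"
    using "3.prems"(3) letter_inv_invol[of t] by (auto simp: reduced_word_simps simp del: letter_inv_invol)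
  ultimately have "N ?z < N (\<phi> (letter_val G s) ?z)"
    using expand[of "letter_inv t" s ?z] st z IH by (simp del: mem_Sigma_iff)
  moreover have "\<phi> (eval_word G (s # t # w)) y = \<phi> (letter_val G s) ?z"
    using "3.prems" by (intro act_Cons) auto
  ultimately show ?case
    using IH by simp
qed simp

lemma reduced_word_no_fixed_point:
  assumes "w \<noteq> []" "set w \<subseteq> X \<times> UNIV" "reduced_word w" "y \<in> Y"
  shows "\<phi> (eval_word G w) y \<noteq> y"
  using assms
proof (induction "length w" arbitrary: w y rule: less_induct)
  case less
  show ?case
  proof
    assume fixed: "\<phi> (eval_word G w) y = y"
    obtain s u where w: "w = s # u" using less.prems by (cases w) auto
    have s: "s \<in> X \<times> UNIV" using less.prems w by simp
    define t where "t = last w"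
    have t: "t \<in> X \<times> UNIV" using less.prems(1,2) unfolding t_def by (meson last_in_set subsetD)
    \<comment> \<open>Otherwise \<open>w\<close> would increase the height of \<open>y\<close>,
      which it fixes. The inverse word gives the same for \<open>letter_inv s\<close> below.\<close>
    have t_le: "N (\<phi> (letter_val G t) y) \<le> N y"
      using reduced_word_expands[OF less.prems] fixed unfolding t_def by fastforce
    have "\<phi> (eval_word G (word_inv w)) y = y"
      using orbit_sym_aux[of "eval_word G w" y y] fixed less.prems Y_sub
      by (auto simp: eval_word_inv[OF X_closed] eval_word_closed[OF X_closed])
    moreover have "word_inv w \<noteq> []" "set (word_inv w) \<subseteq> X \<times> UNIV" "reduced_word (word_inv w)"
        "last (word_inv w) = letter_inv s"
      using less.prems w by (auto simp: reduced_word_inv) (auto simp: word_inv_def letter_inv_def)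
    ultimately have "N (\<phi> (letter_val G (letter_inv s)) y) \<le> N y"
      using reduced_word_expands[of "word_inv w" y] less.prems(4) by fastforce
    \<comment> \<open>At most one letter fails to raise the height of \<open>y\<close>, so the two
      letters found coincide.\<close>
    with expand[OF t, of "letter_inv s" y] t_le less.prems(4) s have ts: "t = letter_inv s"
      by (metis letter_inv_mem not_less)
    have "u \<noteq> []" using ts w unfolding t_def by (metis last.simps letter_inv_neq)
    then obtain x where u: "u = x @ [t]"
      using w t_def by (metis append_butlast_last_id last_ConsR)
    \<comment> \<open>Otherwise \<open>w\<close> would be a letter followed by its inverse.\<close>
    have "x \<noteq> []" using less.prems(3) w u ts by (auto simp: reduced_word_simps)
    have x: "set x \<subseteq> X \<times> UNIV" using less.prems w u by auto
    \<comment> \<open>Conjugation by \<open>t\<close> turns the fixed point \<open>y\<close> of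
      \<open>w\<close> into a fixed point \<open>z\<close> of the shorter word
      \<open>x\<close>.\<close>
    define z where "z = \<phi> (letter_val G t) y"
    have z: "z \<in> Y" unfolding z_def using Y_inv t less.prems(4) by blast
    have "eval_word G u = eval_word G x \<otimes> letter_val G t"
      using x t u by (simp add: eval_word_append[OF X_closed] letter_val_closed[OF X_closed])
    then have u_y: "\<phi> (eval_word G u) y = \<phi> (eval_word G x) z"
      using less.prems(4) Y_sub t x unfolding z_def
      by (auto simp: composition_rule letter_val_closed[OF X_closed] eval_word_closed[OF X_closed])
    have "y = \<phi> (letter_val G s) (\<phi> (eval_word G u) y)"
      using fixed w act_Cons less.prems by metis
    then have "z = \<phi> (letter_val G t) (\<phi> (letter_val G s) (\<phi> (eval_word G x) z))"
      using u_y z_def by simp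
    then have "\<phi> (eval_word G x) z = z"
      using act_letter_inv[OF s act_closed[OF x z]] ts by simp
    moreover have "reduced_word x"
      using less.prems(3) reduced_word_append[of "[s]" u] reduced_word_append[of x "[t]"] w u by simp
    ultimately show False
      using less.hyps[of x z] \<open>x \<noteq> []\<close> x z w u by simp
  qed
qed

text \<open>A word with value one would fix every point of \<open>Y\<close>, and there is such a
  point.\<close>

lemma free_basis_generate: "Y \<noteq> {} \<Longrightarrow> free_basis G (generate G X) X"
  using reduced_word_no_fixed_point act_one X_closed unfolding free_basis_def by fastforce

lemma generate_no_fixed_point:
  assumes "g \<in> generate G X" "y \<in> Y" "\<phi> g y = y"
  shows "g = \<one>"
proof -
  obtain w where "set w \<subseteq> X \<times> UNIV" "reduced_word w" "g = eval_word G w"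
    using generate_eq_eval_word[OF X_closed assms(1)] by blast
  then show ?thesis
    using reduced_word_no_fixed_point[of w y] assms by (cases "w = []") auto
qed

end

section \<open>Non-Archimedean norms\<close>

context nonarch_valuation
begin

lemma val_0 [simp]: "v 0 = 0"
  by (simp add: val_eq_0_iff)

lemma val_1 [simp]: "v 1 = 1"
  using val_mult[of 1 1] val_eq_0_iff[of 1] by simp

lemma val_minus [simp]: "v (- x) = v x"
proof -
  have "v (- 1) * v (- 1) = 1"
    using val_mult[of "- 1" "- 1"] by simp
  then have "v (- 1) = 1"
    using val_nonneg[of "- 1"] square_eq_1_iff[of "v (- 1)"] by auto
  then show ?thesis
    using val_mult[of "- 1" x] by simp
qed

lemma val_diff_swap: "v (x - y) = v (y - x)"
  using val_minus[of "x - y"] by simp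

lemma val_power: "v (x ^ k) = v x ^ k"
  by (induction k) (simp_all add: val_mult)

lemma val_of_nat_le_1: "v (of_nat m) \<le> 1"
proof (induction m)
  case (Suc m)
  then show ?case using val_ultra[of 1 "of_nat m"] by simp
qed simp

lemma val_of_int_le_1: "v (of_int m) \<le> 1"
  using val_of_nat_le_1 by (cases m) (simp_all del: of_nat_Suc)

text \<open>The quotient is an integer, hence of value at most 1. This turns congruences modulo
  \<open>M\<close> into valuation bounds.\<close>

lemma val_of_int_dvd:
  assumes "m dvd z"
  shows "v (of_int z) \<le> v (of_int m)"
  using assms val_of_int_le_1 val_nonneg
  by (auto simp: val_mult mult_left_le elim!: dvdE)

section \<open>Positive residue characteristic\<close>

text \<open>Adding the class of 1 moves the class of \<open>m\<close> to that of
  \<open>Suc m\<close>. Hence a multiple of the unit vanishes only for integers in the maximal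
  ideal.\<close>

lemma add_pow_residue_field:
  "add_pow (residue_field v) m \<one>\<^bsub>residue_field v\<^esub> = {x + of_nat m |x. x \<in> max_ideal v}"
proof (induction m)
  case 0
  show ?case
    by (simp add: residue_field_def FactRing_def add_pow_def nat_pow_def)
next
  case (Suc m)
  let ?k = "residue_field v"
  have one: "\<one>\<^bsub>?k\<^esub> = {x + 1 |x. x \<in> max_ideal v}"
    by (auto simp: residue_field_def FactRing_def a_r_coset_def')
  have add: "A \<oplus>\<^bsub>?k\<^esub> B = {x + y |x y. x \<in> A \<and> y \<in> B}" for A B
    by (auto simp: residue_field_def FactRing_def set_add_def')
  have "add_pow ?k (Suc m) \<one>\<^bsub>?k\<^esub> = add_pow ?k m \<one>\<^bsub>?k\<^esub> \<oplus>\<^bsub>?k\<^esub> \<one>\<^bsub>?k\<^esub>"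
    by (simp add: add_pow_def nat_pow_def)
  also have "\<dots> = {x + of_nat m + (y + 1) |x y. x \<in> max_ideal v \<and> y \<in> max_ideal v}"
    unfolding add Suc.IH unfolding one by auto
  also have "\<dots> = {x + of_nat (Suc m) |x. x \<in> max_ideal v}"
  proof (intro equalityI subsetI)
    fix z assume "z \<in> {x + of_nat m + (y + 1) |x y. x \<in> max_ideal v \<and> y \<in> max_ideal v}"
    then obtain x y where "z = (x + y) + of_nat (Suc m)" "x \<in> max_ideal v" "y \<in> max_ideal v"
      by (auto simp: algebra_simps)
    moreover from this have "x + y \<in> max_ideal v"
      using val_ultra[of x y] by (auto simp: max_ideal_def)
    ultimately show "z \<in> {x + of_nat (Suc m) |x. x \<in> max_ideal v}" by blast
  next
    fix z assume "z \<in> {x + of_nat (Suc m) |x. x \<in> max_ideal v}"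
    then obtain x where "z = x + of_nat m + (0 + 1)" "x \<in> max_ideal v"
      by (auto simp: algebra_simps)
    moreover have "0 \<in> max_ideal v" by (simp add: max_ideal_def)
    ultimately show "z \<in> {x + of_nat m + (y + 1) |x y. x \<in> max_ideal v \<and> y \<in> max_ideal v}" by blast
  qed
  finally show ?case .
qed

lemma ring_char_residue_field_pos:
  assumes "ring_char (residue_field v) > 0"
  shows "\<exists>m>0. v (of_nat m) < 1"
proof -
  obtain m :: nat where m: "m > 0"
      "add_pow (residue_field v) m \<one>\<^bsub>residue_field v\<^esub> = \<zero>\<^bsub>residue_field v\<^esub>"
    using assms by (auto simp: ring_char_def split: if_splits)
  \<comment> \<open>The zero of the quotient is the ideal itself, so it suffices that
    \<open>m\<close> belongs to its own class.\<close>
  have "0 + of_nat m \<in> {x + of_nat m |x. x \<in> max_ideal v}"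
    by (fastforce simp: max_ideal_def)
  then have "of_nat m \<in> max_ideal v"
    using m(2) unfolding add_pow_residue_field by (simp add: residue_field_def FactRing_def)
  then show ?thesis
    using m(1) by (auto simp: max_ideal_def)
qed

section \<open>The maximum norm and its balls\<close>

lemma vnorm_le_iff: "y \<in> carrier_vec d \<Longrightarrow> d > 0 \<Longrightarrow> vnorm v y \<le> r \<longleftrightarrow> (\<forall>i<d. v (y $ i) \<le> r)"
  by (auto simp: vnorm_def Max_le_iff lessThan_empty_iff)

lemma vnorm_less_iff: "y \<in> carrier_vec d \<Longrightarrow> d > 0 \<Longrightarrow> vnorm v y < r \<longleftrightarrow> (\<forall>i<d. v (y $ i) < r)"
  by (auto simp: vnorm_def Max_less_iff lessThan_empty_iff)

lemma vnorm_ultra: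
  assumes "x \<in> carrier_vec d" "y \<in> carrier_vec d" "z \<in> carrier_vec d" "d > 0"
  shows "vnorm v (x - z) \<le> max (vnorm v (x - y)) (vnorm v (y - z))"
proof -
  have "v ((x - z) $ i) \<le> max (vnorm v (x - y)) (vnorm v (y - z))" if i: "i < d" for i
  proof -
    have "v ((x - z) $ i) \<le> max (v ((x - y) $ i)) (v ((y - z) $ i))"
      using val_ultra[of "x $ i - y $ i" "y $ i - z $ i"] assms i by simp
    moreover have "v ((x - y) $ i) \<le> vnorm v (x - y)" "v ((y - z) $ i) \<le> vnorm v (y - z)"
      using vnorm_le_iff[of "x - y" d] vnorm_le_iff[of "y - z" d] assms i by auto
    ultimately show ?thesis by linarith
  qed
  then show ?thesis using assms by (subst vnorm_le_iff[of _ d]) auto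
qed

lemma vnorm_diff_swap:
  assumes "x \<in> carrier_vec d" "y \<in> carrier_vec d"
  shows "vnorm v (x - y) = vnorm v (y - x)"
  unfolding vnorm_def using assms
  by (auto intro!: arg_cong[where f = Max] image_cong simp: val_diff_swap)

text \<open>By the ultrametric inequality a move shorter than \<open>r\<close> cannot carry a point
  across the distance \<open>r\<close> from \<open>x\<close>. For the sphere the inequality is also
  applied from \<open>z\<close> back to \<open>y\<close>.\<close>

lemma vball_perturb:
  assumes "x \<in> carrier_vec d" "y \<in> carrier_vec d" "z \<in> carrier_vec d" "d > 0"
    and "vnorm v (z - y) < r"
  shows "y \<in> vcball v x r \<Longrightarrow> z \<in> vcball v x r"
    and "y \<in> vball v x r \<Longrightarrow> z \<in> vball v x r"
    and "y \<in> vsphere v x r \<Longrightarrow> z \<in> vsphere v x r"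
  using vnorm_ultra[of z d y x] vnorm_ultra[of y d z x] vnorm_diff_swap[of y d z] assms
  by (auto simp: vcball_def vball_def vsphere_def)

end

section \<open>Integer matrices acting around a point\<close>

locale affine_action =
  fixes d :: nat and xh :: "'a::field_char_0 vec"
  assumes dim_ge: "d \<ge> 2" and xh_closed: "xh \<in> carrier_vec d"
begin

text \<open>An integer 2 by 2 block extended by the identity. The entries stay of type
  \<open>int\<close>, so that divisibility and integer kernel vectors remain available.\<close>

definition blk :: "int \<Rightarrow> int \<Rightarrow> int \<Rightarrow> int \<Rightarrow> 'a mat" where
  "blk a b c e = mat d d (\<lambda>(i, j).
     if i = 0 \<and> j = 0 then of_int a else if i = 0 \<and> j = 1 then of_int b
     else if i = 1 \<and> j = 0 then of_int c else if i = 1 \<and> j = 1 then of_int e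
     else if i = j then 1 else 0)"

text \<open>The translation part is chosen so that \<open>xh\<close> is fixed: \<open>y\<close> goes
  to \<open>xh + A (y - xh)\<close>, with \<open>A\<close> the block matrix.\<close>

definition aff :: "int \<Rightarrow> int \<Rightarrow> int \<Rightarrow> int \<Rightarrow> 'a vec \<Rightarrow> 'a vec" where
  "aff a b c e = affine_map d (blk a b c e) (xh - blk a b c e *\<^sub>v xh)"

lemma blk_closed: "blk a b c e \<in> carrier_mat d d"
  by (simp add: blk_def)

lemma det_blk: "det (blk a b c e) = of_int (a * e - b * c)"
proof -
  let ?S = "\<lambda>z::int. mat 1 1 (\<lambda>_. of_int z) :: 'a mat"
  define B :: "'a mat" where "B = mat 2 2 (\<lambda>(i, j).
    of_int (if i = 0 then if j = 0 then a else b else if j = 0 then c else e))"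
  have "B = four_block_mat (?S a) (?S b) (?S c) (?S e)"
    by (rule eq_matI) (auto simp: B_def less_2_cases_iff)
  \<comment> \<open>Blocks of size 1 commute, as the determinant formula for block matrices
    requires.\<close>
  also have "det \<dots> = det (?S a * ?S e - ?S b * ?S c)"
    by (rule det_four_block_mat) (auto simp: scalar_prod_def)
  also have "\<dots> = of_int (a * e - b * c)"
    by (subst det_single) (auto simp: scalar_prod_def)
  finally have "det B = of_int (a * e - b * c)" .
  moreover obtain m where m: "d = Suc (Suc m)"
    using dim_ge by (metis add_2_eq_Suc le_Suc_ex)
  have "blk a b c e = four_block_mat B (0\<^sub>m 2 m) (0\<^sub>m m 2) (1\<^sub>m m)"
  proof (rule eq_matI)
    fix i j
    assume "i < dim_row (four_block_mat B (0\<^sub>m 2 m) (0\<^sub>m m 2) (1\<^sub>m m))"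
      "j < dim_col (four_block_mat B (0\<^sub>m 2 m) (0\<^sub>m m 2) (1\<^sub>m m))"
    then have "i < Suc (Suc m)" "j < Suc (Suc m)" by (simp_all add: B_def)
    then show "blk a b c e $$ (i, j) = four_block_mat B (0\<^sub>m 2 m) (0\<^sub>m m 2) (1\<^sub>m m) $$ (i, j)"
      unfolding blk_def B_def unfolding m
      by (cases i; cases "i - 1"; cases j; cases "j - 1") simp_all
  qed (simp_all add: blk_def B_def, simp_all add: m)
  ultimately show ?thesis
    by (simp add: det_four_block_mat_lower_left_zero[of _ 2 _ m] B_def)
qed

lemma blk_mult_vec:
  assumes "y \<in> carrier_vec d"
  shows "blk a b c e *\<^sub>v y = vec d (\<lambda>i.
    if i = 0 then of_int a * y $ 0 + of_int b * y $ 1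
    else if i = 1 then of_int c * y $ 0 + of_int e * y $ 1 else y $ i)"
proof (rule eq_vecI)
  fix i assume "i < dim_vec (vec d (\<lambda>i.
    if i = 0 then of_int a * y $ 0 + of_int b * y $ 1
    else if i = 1 then of_int c * y $ 0 + of_int e * y $ 1 else y $ i))"
  then have i: "i < d" by simp
  obtain m where m: "d = Suc (Suc m)"
    using dim_ge by (metis add_2_eq_Suc le_Suc_ex)
  let ?entry = "\<lambda>j. if i = 0 \<and> j = 0 then of_int a else if i = 0 \<and> j = 1 then of_int b
     else if i = 1 \<and> j = 0 then of_int c else if i = 1 \<and> j = 1 then of_int e
     else if i = j then 1 else 0 :: 'a"
  have row: "(blk a b c e *\<^sub>v y) $ i = (\<Sum>j=0..<d. ?entry j * y $ j)"
    using i assms by (auto simp: blk_def scalar_prod_def intro!: sum.cong)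
  consider "i = 0" | "i = 1" | "i \<ge> 2" by linarith
  then have "(blk a b c e *\<^sub>v y) $ i =
    (if i = 0 then of_int a * y $ 0 + of_int b * y $ 1
     else if i = 1 then of_int c * y $ 0 + of_int e * y $ 1 else y $ i)"
  proof cases
    case 3
    have "(\<Sum>j=0..<d. ?entry j * y $ j) = (\<Sum>j=0..<d. if j = i then y $ i else 0)"
      using 3 i by (intro sum.cong) auto
    then show ?thesis using row 3 i by simp
  qed (unfold row, auto simp: m sum.atLeast0_lessThan_Suc_shift simp del: sum.op_ivl_Suc)
  then show "(blk a b c e *\<^sub>v y) $ i = vec d (\<lambda>i.
    if i = 0 then of_int a * y $ 0 + of_int b * y $ 1
    else if i = 1 then of_int c * y $ 0 + of_int e * y $ 1 else y $ i) $ i"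
    using i by simp
qed (simp add: blk_def)

lemma aff_apply:
  assumes "y \<in> carrier_vec d"
  shows "aff a b c e y = vec d (\<lambda>i.
    if i = 0 then xh $ 0 + of_int a * (y $ 0 - xh $ 0) + of_int b * (y $ 1 - xh $ 1)
    else if i = 1 then xh $ 1 + of_int c * (y $ 0 - xh $ 0) + of_int e * (y $ 1 - xh $ 1)
    else y $ i)"
  using assms xh_closed dim_ge
  by (intro eq_vecI) (auto simp: aff_def affine_map_def blk_mult_vec algebra_simps)

lemma aff_closed: "y \<in> carrier_vec d \<Longrightarrow> aff a b c e y \<in> carrier_vec d"
  by (simp add: aff_apply)

text \<open>All these maps fix \<open>xh\<close>, so composing them amounts to multiplying their 2
  by 2 blocks.\<close>

lemma aff_aff:
  assumes "y \<in> carrier_vec d"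
  shows "aff a b c e (aff a' b' c' e' y) =
    aff (a * a' + b * c') (a * b' + b * e') (c * a' + e * c') (c * b' + e * e') y"
  using assms dim_ge xh_closed
  by (intro eq_vecI) (auto simp: aff_apply algebra_simps)

lemma aff_one: "y \<in> carrier_vec d \<Longrightarrow> aff 1 0 0 1 y = y"
  using dim_ge xh_closed by (intro eq_vecI) (auto simp: aff_apply)

lemma aff_extensional: "aff a b c e \<in> extensional (carrier_vec d)"
  by (simp add: aff_def affine_map_def)

abbreviation "BG \<equiv> BijGroup (carrier_vec d :: 'a vec set)"

lemma aff_Bij:
  assumes "a * e - b * c = 1"
  shows "aff a b c e \<in> carrier BG"
proof -
  \<comment> \<open>The adjugate block is the inverse, since the determinant is 1.\<close>
  have "aff a b c e (aff e (- b) (- c) a y) = y" "aff e (- b) (- c) a (aff a b c e y) = y"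
    if "y \<in> carrier_vec d" for y
    using assms that by (simp_all add: aff_aff aff_one algebra_simps)
  then have "bij_betw (aff a b c e) (carrier_vec d) (carrier_vec d)"
    by (intro bij_betw_byWitness[where f' = "aff e (- b) (- c) a"]) (auto intro: aff_closed)
  then show ?thesis
    using aff_extensional by (simp add: BijGroup_def Bij_def)
qed

lemma aff_mult:
  assumes "a * e - b * c = 1" "a' * e' - b' * c' = 1"
  shows "aff a b c e \<otimes>\<^bsub>BG\<^esub> aff a' b' c' e' =
    aff (a * a' + b * c') (a * b' + b * e') (c * a' + e * c') (c * b' + e * e')"
proof -
  have "aff a b c e \<otimes>\<^bsub>BG\<^esub> aff a' b' c' e' = compose (carrier_vec d) (aff a b c e) (aff a' b' c' e')"
    using aff_Bij[OF assms(1)] aff_Bij[OF assms(2)] by (simp add: BijGroup_def)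
  also have "\<dots> = aff (a * a' + b * c') (a * b' + b * e') (c * a' + e * c') (c * b' + e * e')"
    by (rule extensionalityI[of _ "carrier_vec d"])
      (auto simp: aff_extensional compose_def aff_aff)
  finally show ?thesis .
qed

lemma aff_1_eq_one: "aff 1 0 0 1 = \<one>\<^bsub>BG\<^esub>"
  by (rule extensionalityI[of _ "carrier_vec d"])
    (auto simp: aff_extensional BijGroup_def aff_one)

lemma inv_aff:
  assumes "a * e - b * c = 1"
  shows "inv\<^bsub>BG\<^esub> (aff a b c e) = aff e (- b) (- c) a"
proof (rule group.inv_equality[OF group_BijGroup])
  show "aff e (- b) (- c) a \<otimes>\<^bsub>BG\<^esub> aff a b c e = \<one>\<^bsub>BG\<^esub>"
    using assms by (subst aff_mult) (simp_all add: algebra_simps flip: aff_1_eq_one)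
qed (use assms in \<open>auto intro!: aff_Bij simp: algebra_simps\<close>)

text \<open>The principal congruence subgroup of level \<open>M\<close> of
  \<open>SL(2, \<int>)\<close>, acting around the first two coordinates of
  \<open>xh\<close>.\<close>

definition congruence_group :: "int \<Rightarrow> ('a vec \<Rightarrow> 'a vec) set" where
  "congruence_group M = {aff a b c e | a b c e.
     a * e - b * c = 1 \<and> M dvd a - 1 \<and> M dvd b \<and> M dvd c \<and> M dvd e - 1}"

lemma congruence_group_subgroup: "subgroup (congruence_group M) BG"
proof (rule group.subgroupI[OF group_BijGroup])
  show "congruence_group M \<subseteq> carrier BG"
    using aff_Bij by (auto simp: congruence_group_def)
  have "aff 1 0 0 1 \<in> congruence_group M"
    unfolding congruence_group_def
    by (intro CollectI exI[of _ 1] exI[of _ 0] conjI refl) auto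
  then show "congruence_group M \<noteq> {}" by blast
next
  fix f assume "f \<in> congruence_group M"
  then obtain a b c e where "f = aff a b c e" and 1: "a * e - b * c = 1"
    and 2: "M dvd a - 1" "M dvd b" "M dvd c" "M dvd e - 1"
    by (auto simp: congruence_group_def)
  moreover have "e * a - - b * - c = 1" using 1 by (simp add: algebra_simps)
  moreover have "M dvd - b" "M dvd - c" using 2 by simp_all
  ultimately show "inv\<^bsub>BG\<^esub> f \<in> congruence_group M"
    unfolding congruence_group_def using inv_aff by blast
next
  fix f g assume "f \<in> congruence_group M" "g \<in> congruence_group M"
  then obtain a b c e a' b' c' e' where fg: "f = aff a b c e" "g = aff a' b' c' e'"
    and 1: "a * e - b * c = 1" "a' * e' - b' * c' = 1"
    and 2: "M dvd a - 1" "M dvd b" "M dvd c" "M dvd e - 1"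
      "M dvd a' - 1" "M dvd b'" "M dvd c'" "M dvd e' - 1"
    unfolding congruence_group_def by blast
  have "(a * a' + b * c') * (c * b' + e * e') - (a * b' + b * e') * (c * a' + e * c') =
      (a * e - b * c) * (a' * e' - b' * c')"
    by (simp add: algebra_simps)
  \<comment> \<open>The first two expressions are the diagonal entries of the product minus 1,
    rearranged so that every summand is visibly divisible by \<open>M\<close>.\<close>
  moreover have "M dvd a * (a' - 1) + (a - 1) + b * c'" "M dvd c * b' + e * (e' - 1) + (e - 1)"
    "M dvd a * b' + b * e'" "M dvd c * a' + e * c'"
    using 2 by (simp_all add: dvd_add)
  then have "M dvd (a * a' + b * c') - 1" "M dvd (c * b' + e * e') - 1"
    by (simp_all add: algebra_simps)
  ultimately show "f \<otimes>\<^bsub>BG\<^esub> g \<in> congruence_group M"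
    unfolding fg aff_mult[OF 1] congruence_group_def
    using \<open>M dvd a * b' + b * e'\<close> \<open>M dvd c * a' + e * c'\<close> 1 by auto
qed

end

section \<open>A free group without the eigenvalue 1\<close>

text \<open>If neither map expanded, \<open>q + m * p\<close> and \<open>q + n * p\<close> would
  both be at most \<open>2 * \<bar>p\<bar> / \<bar>b\<bar>\<close> in absolute value. They differ by
  a nonzero multiple of \<open>p\<close>, so
  \<open>\<bar>b\<bar> * \<bar>p\<bar> \<le> 4 * \<bar>p\<bar>\<close>. As
  \<open>\<bar>b\<bar> \<ge> 5\<close>, this forces \<open>p = 0\<close> and then
  \<open>q = 0\<close>.\<close>

lemma shear_expanding:
  fixes b b' m n p q :: int
  assumes "\<bar>b\<bar> \<ge> 5" "\<bar>b'\<bar> = \<bar>b\<bar>" "m \<noteq> n" "(p, q) \<noteq> (0, 0)"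
    and "\<bar>p + b * (q + m * p)\<bar> \<le> \<bar>p\<bar>"
  shows "\<bar>p\<bar> < \<bar>p + b' * (q + n * p)\<bar>"
proof (rule ccontr)
  assume "\<not> ?thesis"
  then have "\<bar>b' * (q + n * p)\<bar> \<le> 2 * \<bar>p\<bar>" "\<bar>b * (q + m * p)\<bar> \<le> 2 * \<bar>p\<bar>"
    using assms(5) by linarith+
  then have le: "\<bar>b\<bar> * \<bar>q + n * p\<bar> \<le> 2 * \<bar>p\<bar>" "\<bar>b\<bar> * \<bar>q + m * p\<bar> \<le> 2 * \<bar>p\<bar>"
    using assms(2) by (simp_all add: abs_mult)
  have "5 * \<bar>p\<bar> \<le> \<bar>b\<bar> * (\<bar>n - m\<bar> * \<bar>p\<bar>)"
    using assms(1,3) mult_right_mono[of 1 "\<bar>n - m\<bar>" "\<bar>p\<bar>"]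
    by (intro mult_mono) auto
  also have "\<bar>n - m\<bar> * \<bar>p\<bar> = \<bar>(q + n * p) - (q + m * p)\<bar>"
    by (simp add: algebra_simps flip: abs_mult)
  also have "\<bar>b\<bar> * \<dots> \<le> \<bar>b\<bar> * (\<bar>q + n * p\<bar> + \<bar>q + m * p\<bar>)"
    by (intro mult_left_mono) linarith+
  finally have "5 * \<bar>p\<bar> \<le> \<bar>b\<bar> * \<bar>q + n * p\<bar> + \<bar>b\<bar> * \<bar>q + m * p\<bar>"
    by (simp only: distrib_left)
  then have "p = 0" using le by linarith
  then have "\<bar>b\<bar> * \<bar>q\<bar> \<le> 0" using le by simp
  then show False using assms(1,4) \<open>p = 0\<close> by (auto simp: mult_le_0_iff)
qed

text \<open>A nonzero row turned by a right angle is annihilated by both rows, as the determinant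
  vanishes. If both rows are zero, any vector works.\<close>

lemma ex_kernel_vector:
  fixes a b c e :: int
  assumes "a * e = b * c"
  shows "\<exists>p q. (p, q) \<noteq> (0, 0) \<and> a * p + b * q = 0 \<and> c * p + e * q = 0"
proof -
  consider "(b, - a) \<noteq> (0, 0)" | "(e, - c) \<noteq> (0, 0)" | "a = 0" "b = 0" "c = 0" "e = 0"
    by auto
  then show ?thesis
  proof cases
    case 1
    then show ?thesis using assms by (intro exI[of _ b] exI[of _ "- a"]) (auto simp: algebra_simps)
  next
    case 2
    then show ?thesis using assms by (intro exI[of _ e] exI[of _ "- c"]) (auto simp: algebra_simps)
  qed (auto intro!: exI[of _ 1])
qed

context affine_action
begin

text \<open>A copy of \<open>\<int>\<close> squared based at \<open>xh\<close>, the other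
  coordinates being frozen. On it the maps \<open>aff\<close> act as integer matrices.\<close>

definition lattice_pt :: "int \<Rightarrow> int \<Rightarrow> 'a vec" where
  "lattice_pt p q = vec d (\<lambda>i. if i = 0 then xh $ 0 + of_int p
     else if i = 1 then xh $ 1 + of_int q else xh $ i)"

text \<open>Meant for lattice points, where characteristic 0 makes the integer unique.\<close>

definition height :: "'a vec \<Rightarrow> int" where
  "height y = \<bar>THE p. y $ 0 = xh $ 0 + of_int p\<bar>"

lemma lattice_pt_closed [simp]: "lattice_pt p q \<in> carrier_vec d"
  by (simp add: lattice_pt_def)

lemma lattice_pt_eq_iff: "lattice_pt p q = lattice_pt p' q' \<longleftrightarrow> p = p' \<and> q = q'"
proof
  assume eq: "lattice_pt p q = lattice_pt p' q'"
  have "lattice_pt p q $ 0 = lattice_pt p' q' $ 0" "lattice_pt p q $ 1 = lattice_pt p' q' $ 1"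
    by (simp_all only: eq)
  then show "p = p' \<and> q = q'"
    using dim_ge by (simp add: lattice_pt_def)
qed simp

lemma height_lattice_pt [simp]: "height (lattice_pt p q) = \<bar>p\<bar>"
  using dim_ge by (simp add: height_def lattice_pt_def)

lemma aff_lattice_pt: "aff a b c e (lattice_pt p q) = lattice_pt (a * p + b * q) (c * p + e * q)"
  using dim_ge by (intro eq_vecI) (auto simp: aff_apply lattice_pt_def)

text \<open>Expanded, this maps \<open>(p, q)\<close> to \<open>(p', n p' + (q + n p))\<close> with \<open>p' = p + b (q + n p)\<close>, so the
  direction in which it does not expand the first coordinate is close to that of \<open>(1, -n)\<close>.\<close>

definition hyp :: "int \<Rightarrow> int \<Rightarrow> 'a vec \<Rightarrow> 'a vec" where
  "hyp b n = aff (1 + b * n) b (n * (2 + b * n)) (1 + b * n)"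

lemma hyp_lattice_pt:
  "hyp b n (lattice_pt p q) =
    lattice_pt (p + b * (q + n * p)) (n * (2 + b * n) * p + (1 + b * n) * q)"
  by (simp add: hyp_def aff_lattice_pt lattice_pt_eq_iff algebra_simps)

lemma hyp_in_congruence_group:
  assumes "M dvd b" "M dvd n"
  shows "hyp b n \<in> congruence_group M"
  unfolding hyp_def congruence_group_def
  using assms
  by (intro CollectI exI[of _ "1 + b * n"] exI[of _ b] exI[of _ "n * (2 + b * n)"] conjI refl)
    (auto simp: algebra_simps)

lemma hyp_closed: "hyp b n \<in> carrier BG"
  unfolding hyp_def by (rule aff_Bij) (simp add: algebra_simps)

text \<open>The adjugate negates the off-diagonal entries, which are odd in \<open>(b, n)\<close>,
  and \<open>b * n\<close> is unchanged. So inverses of generators belong to the same family, with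
  negative parameters.\<close>

lemma inv_hyp: "inv\<^bsub>BG\<^esub> (hyp b n) = hyp (- b) (- n)"
  unfolding hyp_def by (subst inv_aff) (simp_all add: algebra_simps)

text \<open>Multiples of \<open>M\<close> keep the maps in the congruence group, and the factor 5
  serves \<open>shear_expanding\<close>. Only positive \<open>k\<close> occur, because negative
  parameters stand for the inverses.\<close>

definition gens :: "int \<Rightarrow> ('a vec \<Rightarrow> 'a vec) set" where
  "gens M = (\<lambda>k. hyp (5 * M) (M * k)) ` {1..}"

definition hyp_group :: "int \<Rightarrow> ('a vec \<Rightarrow> 'a vec) set" where
  "hyp_group M = generate BG (gens M)"

lemma infinite_gens:
  assumes "M > 0"
  shows "infinite (gens M)"
proof -
  have "inj_on (\<lambda>k. hyp (5 * M) (M * k)) {1..}"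
  proof (rule inj_onI)
    fix k l assume "hyp (5 * M) (M * k) = hyp (5 * M) (M * l)"
    \<comment> \<open>The first coordinate of the image of \<open>(1, 0)\<close> is
      \<open>1 + 5 * M * (M * k)\<close>, which determines \<open>k\<close>.\<close>
    then have "hyp (5 * M) (M * k) (lattice_pt 1 0) = hyp (5 * M) (M * l) (lattice_pt 1 0)" by simp
    then show "k = l" using assms by (simp add: hyp_lattice_pt lattice_pt_eq_iff)
  qed
  then show ?thesis
    unfolding gens_def by (simp add: finite_image_iff infinite_Ici)
qed

text \<open>One signed integer encodes a letter: \<open>\<bar>n\<bar>\<close> picks the generator
  and the sign its exponent. Distinct letters thus have distinct \<open>n\<close>, as
  \<open>shear_expanding\<close> demands.\<close>

lemma gens_letter:
  assumes "s \<in> gens M \<times> UNIV" "M > 0"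
  shows "\<exists>n. n \<noteq> 0 \<and> letter_val BG s = hyp (sgn n * (5 * M)) n \<and> s = (hyp (5 * M) \<bar>n\<bar>, n > 0)"
proof -
  obtain k where k: "fst s = hyp (5 * M) (M * k)" "k \<ge> 1"
    using assms(1) by (auto simp: gens_def)
  have pos: "M * k > 0" using k assms(2) by simp
  show ?thesis
  proof (cases "snd s")
    case True
    then show ?thesis using k pos
      by (intro exI[of _ "M * k"]) (auto simp: letter_val_def prod_eq_iff)
  next
    case False
    then show ?thesis using k pos
      by (intro exI[of _ "- (M * k)"]) (auto simp: letter_val_def prod_eq_iff inv_hyp sgn_minus)
  qed
qed


section \<open>Ping-pong on the nonzero lattice points\<close>

definition punctured_lattice :: "'a vec set" where
  "punctured_lattice = {lattice_pt p q |p q. (p, q) \<noteq> (0, 0)}"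

lemma expanding_action_gens:
  assumes "M > 0"
  shows "expanding_action BG (carrier_vec d) (\<lambda>f. f) (gens M) punctured_lattice height"
proof -
  have "group_action BG (carrier_vec d) (\<lambda>f. f)"
    by (intro group_action.intro group_hom.intro group_hom_axioms.intro group_BijGroup)
      (auto simp: hom_def)
  moreover have "expanding_action_axioms BG (carrier_vec d) (\<lambda>f. f) (gens M) punctured_lattice height"
  proof
    show "gens M \<subseteq> carrier BG" using hyp_closed by (auto simp: gens_def)
    show "punctured_lattice \<subseteq> carrier_vec d" by (auto simp: punctured_lattice_def)
  next
    fix s :: "('a vec \<Rightarrow> 'a vec) \<times> bool" and y assume s: "s \<in> gens M \<times> UNIV" and "y \<in> punctured_lattice"
    then obtain p q where y: "y = lattice_pt p q" "(p, q) \<noteq> (0, 0)" by (auto simp: punctured_lattice_def)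
    obtain n where "letter_val BG s = hyp (sgn n * (5 * M)) n"
      using gens_letter[OF s assms] by blast
    moreover have "(p + b * (q + n * p), n * (2 + b * n) * p + (1 + b * n) * q) \<noteq> (0, 0)" for b
    proof
      assume eq: "(p + b * (q + n * p), n * (2 + b * n) * p + (1 + b * n) * q) = (0, 0)"
      \<comment> \<open>The second image coordinate minus \<open>n\<close> times the first gives
        back \<open>q + n * p\<close>. If both vanish, so do \<open>q + n * p\<close>, then
        \<open>p\<close>, then \<open>q\<close>.\<close>
      have "q + n * p = (n * (2 + b * n) * p + (1 + b * n) * q) - n * (p + b * (q + n * p))"
        by (simp add: algebra_simps)
      with eq have "q + n * p = 0" by simp
      with eq y(2) show False by simp
    qed
    ultimately show "letter_val BG s y \<in> punctured_lattice"
      unfolding y(1) punctured_lattice_def by (simp only: hyp_lattice_pt) blast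
  next
    fix s t :: "('a vec \<Rightarrow> 'a vec) \<times> bool" and y
    assume s: "s \<in> gens M \<times> UNIV" and t: "t \<in> gens M \<times> UNIV" and st: "s \<noteq> t"
      and y: "y \<in> punctured_lattice" and le: "height (letter_val BG s y) \<le> height y"
    obtain p q where pq: "y = lattice_pt p q" "(p, q) \<noteq> (0, 0)" using y by (auto simp: punctured_lattice_def)
    obtain m where m: "m \<noteq> 0" "letter_val BG s = hyp (sgn m * (5 * M)) m" "s = (hyp (5 * M) \<bar>m\<bar>, m > 0)"
      using gens_letter[OF s assms] by blast
    obtain n where n: "n \<noteq> 0" "letter_val BG t = hyp (sgn n * (5 * M)) n" "t = (hyp (5 * M) \<bar>n\<bar>, n > 0)"
      using gens_letter[OF t assms] by blast
    have "m \<noteq> n" using st m(3) n(3) by auto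
    moreover have "\<bar>sgn m * (5 * M)\<bar> \<ge> 5" "\<bar>sgn n * (5 * M)\<bar> = \<bar>sgn m * (5 * M)\<bar>"
      using m(1) n(1) assms by (simp_all add: abs_mult)
    ultimately show "height y < height (letter_val BG t y)"
      using shear_expanding[of "sgn m * (5 * M)" "sgn n * (5 * M)" m n p q] le pq(2)
      by (simp add: m(2) n(2) pq(1) hyp_lattice_pt)
  qed
  ultimately show ?thesis by (rule expanding_action.intro)
qed

lemma free_hyp_group:
  assumes "M > 0"
  shows "free_subgroup_of_infinite_rank (hyp_group M) BG"
proof -
  interpret expanding_action BG "carrier_vec d" "\<lambda>f. f" "gens M" punctured_lattice height
    by (rule expanding_action_gens[OF assms])
  have "lattice_pt 1 0 \<in> punctured_lattice"
    unfolding punctured_lattice_def by (rule CollectI, rule exI[of _ 1], rule exI[of _ 0]) simp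
  then show ?thesis
    unfolding free_subgroup_of_infinite_rank_def hyp_group_def
    using generate_is_subgroup[OF X_closed] infinite_gens[OF assms] free_basis_generate by blast
qed

lemma hyp_group_congruence: "hyp_group M \<subseteq> congruence_group M"
  unfolding hyp_group_def
proof (rule group.generate_subgroup_incl[OF group_BijGroup _ congruence_group_subgroup])
  show "gens M \<subseteq> congruence_group M"
    by (auto simp: gens_def intro: hyp_in_congruence_group)
qed

section \<open>Fixed points and the excluded affine subspace\<close>

text \<open>The set removed from the space in the theorem; every \<open>aff\<close> fixes it
  pointwise.\<close>

definition axis :: "'a vec set" where
  "axis = {y \<in> carrier_vec d. y $ 0 = xh $ 0 \<and> y $ 1 = xh $ 1}"

text \<open>An element with a fixed point off the axis has \<open>1\<close> as an eigenvalue, and then it also fixes a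
  nonzero integer vector.\<close>

lemma hyp_group_fixed_point:
  assumes "M > 0" "f \<in> hyp_group M" "y \<in> carrier_vec d - axis" "f y = y"
  shows "f = \<one>\<^bsub>BG\<^esub>"
proof -
  obtain a b c e where f: "f = aff a b c e" and det: "a * e - b * c = 1"
    using subsetD[OF hyp_group_congruence assms(2)] unfolding congruence_group_def by blast
  define u w where "u = y $ 0 - xh $ 0" and "w = y $ 1 - xh $ 1"
  have y: "y \<in> carrier_vec d" and uw: "u \<noteq> 0 \<or> w \<noteq> 0"
    using assms(3) by (auto simp: axis_def u_def w_def)
  have "aff a b c e y $ 0 = y $ 0" "aff a b c e y $ 1 = y $ 1"
    using assms(4) f by simp_all
  then have lin: "of_int (a - 1) * u + of_int b * w = 0" "of_int c * u + of_int (e - 1) * w = 0"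
    using y dim_ge by (simp_all add: aff_apply u_def w_def algebra_simps)
  \<comment> \<open>Elimination as in Cramer's rule: \<open>?D\<close> is the determinant of the
    block minus the identity. It annihilates the nonzero vector \<open>(u, w)\<close>, so it is 0 in
    the field and, by characteristic 0, as an integer.\<close>
  let ?D = "(a - 1) * (e - 1) - b * c"
  have "of_int ?D * u = of_int (e - 1) * (of_int (a - 1) * u + of_int b * w)
      - of_int b * (of_int c * u + of_int (e - 1) * w)"
    "of_int ?D * w = of_int (a - 1) * (of_int c * u + of_int (e - 1) * w)
      - of_int c * (of_int (a - 1) * u + of_int b * w)"
    by (simp_all add: algebra_simps)
  then have "of_int ?D = (0 :: 'a)"
    unfolding lin using uw by auto
  then have "(a - 1) * (e - 1) = b * c"
    by (simp only: of_int_eq_0_iff)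
  then obtain p q where pq: "(p, q) \<noteq> (0, 0)" "(a - 1) * p + b * q = 0" "c * p + (e - 1) * q = 0"
    using ex_kernel_vector[of "a - 1" "e - 1" b c] by blast
  then have "f (lattice_pt p q) = lattice_pt p q"
    by (simp add: f aff_lattice_pt lattice_pt_eq_iff algebra_simps)
  moreover have "lattice_pt p q \<in> punctured_lattice" using pq(1) by (auto simp: punctured_lattice_def)
  ultimately show ?thesis
    using expanding_action.generate_no_fixed_point[OF expanding_action_gens[OF assms(1)]] assms(2)
    unfolding hyp_group_def by blast
qed

text \<open>Trivial stabilizers come from \<open>hyp_group_fixed_point\<close>. For each of the four
  sets of the theorem there remain invariance under the congruence group and disjointness from the
  axis.\<close>

lemma hyp_group_acts:
  assumes "M > 0" "S \<subseteq> carrier_vec d - axis"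
    and "\<And>f y. f \<in> congruence_group M \<Longrightarrow> y \<in> S \<Longrightarrow> f y \<in> S"
  shows "acts_without_fixed_points (hyp_group M) (carrier_vec d) S"
proof -
  have "\<one>\<^bsub>BG\<^esub> \<in> hyp_group M"
    unfolding hyp_group_def by (rule generate.one)
  moreover have "\<one>\<^bsub>BG\<^esub> y = y" if "y \<in> S" for y
    using assms(2) that by (auto simp: BijGroup_def)
  ultimately have "stabilizer (BG\<lparr>carrier := hyp_group M\<rparr>) (\<lambda>f. f) y = {\<one>\<^bsub>BG\<^esub>}"
    if "y \<in> S" for y
    using hyp_group_fixed_point[OF assms(1), of _ y] that assms(2)
    by (auto simp: stabilizer_def)
  then show ?thesis
    using assms hyp_group_congruence unfolding acts_without_fixed_points_def by blast
qed

text \<open>The inverse map keeps the axis, so a point sent into the axis already lay on it.\<close>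

lemma congruence_group_off_axis:
  assumes "f \<in> congruence_group M" "y \<in> carrier_vec d - axis"
  shows "f y \<in> carrier_vec d - axis"
proof -
  obtain a b c e where f: "f = aff a b c e" and det: "a * e - b * c = 1"
    using assms(1) by (auto simp: congruence_group_def)
  have y: "y \<in> carrier_vec d" using assms(2) by simp
  have "y \<in> axis" if "f y \<in> axis"
  proof -
    have "aff e (- b) (- c) a (f y) = y"
      using det y by (simp add: f aff_aff aff_one algebra_simps)
    moreover have "aff e (- b) (- c) a z \<in> axis" if "z \<in> axis" for z
      using that dim_ge by (auto simp: axis_def aff_apply)
    ultimately show ?thesis using that by metis
  qed
  then show ?thesis using assms(2) aff_closed y by (auto simp: f)
qed

lemma axis_eq: "axis = (\<lambda>w. vec_first xh 2 @\<^sub>v w) ` carrier_vec (d - 2)"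
proof (intro equalityI subsetI)
  fix y assume y: "y \<in> axis"
  have "y = vec_first xh 2 @\<^sub>v vec_last y (d - 2)"
  proof (rule eq_vecI)
    fix i assume "i < dim_vec (vec_first xh 2 @\<^sub>v vec_last y (d - 2))"
    then have "i < d" using dim_ge by (simp add: vec_first_def vec_last_def)
    moreover have "i = 0 \<or> i = 1 \<or> (\<exists>k. i = Suc (Suc k))" by presburger
    ultimately show "y $ i = (vec_first xh 2 @\<^sub>v vec_last y (d - 2)) $ i"
      using y dim_ge by (auto simp: axis_def vec_first_def vec_last_def)
  qed (use y dim_ge in \<open>auto simp: axis_def\<close>)
  then show "y \<in> (\<lambda>w. vec_first xh 2 @\<^sub>v w) ` carrier_vec (d - 2)"
    by (rule image_eqI[OF _ vec_last_carrier])
next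
  fix y assume "y \<in> (\<lambda>w. vec_first xh 2 @\<^sub>v w) ` carrier_vec (d - 2)"
  then obtain w where y: "y = vec_first xh 2 @\<^sub>v w" and w: "w \<in> carrier_vec (d - 2)" by blast
  have "y \<in> carrier_vec (2 + (d - 2))"
    unfolding y by (rule append_carrier_vec[OF vec_first_carrier w])
  moreover have "y $ 0 = xh $ 0" "y $ 1 = xh $ 1"
    unfolding y by (simp_all add: vec_first_def)
  ultimately show "y \<in> axis" using dim_ge by (simp add: axis_def del: add_2_eq_Suc)
qed

lemma aff_in_SA:
  assumes "a * e - b * c = 1" "xh $ 0 \<in> \<int>" "xh $ 1 \<in> \<int>"
  shows "aff a b c e \<in> SA d \<int>"
proof -
  have "blk a b c e \<in> SL_mats d \<int>"
    using assms(1) by (auto simp: SL_mats_def blk_closed det_blk) (auto simp: blk_def)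
  \<comment> \<open>From the third coordinate on the difference is 0, so only the first two
    coordinates of \<open>xh\<close> matter.\<close>
  moreover have "xh - blk a b c e *\<^sub>v xh \<in> vecs_over d \<int>"
    using assms(2,3) xh_closed by (auto simp: vecs_over_def blk_mult_vec)
  ultimately show ?thesis unfolding SA_def aff_def by blast
qed

end

section \<open>Congruence subgroups and balls\<close>

locale valued_affine_action = nonarch_valuation v + affine_action d xh
  for v :: "'a::field_char_0 \<Rightarrow> real" and d and xh :: "'a vec"
begin

lemma blk_SL_eps:
  assumes "a * e - b * c = 1" "M dvd a - 1" "M dvd b" "M dvd c" "M dvd e - 1"
    and "v (of_int M) < \<epsilon>" "range of_int \<subseteq> R"
  shows "blk a b c e \<in> SL_eps_mats v d R \<epsilon>"
proof -
  have R: "of_int z \<in> R" for z using assms(7) by blast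
  have *: "v (of_int z) < \<epsilon>" if "M dvd z" for z
    using val_of_int_dvd[OF that] assms(6) by linarith
  \<comment> \<open>The instance 0 yields \<open>0 < \<epsilon>\<close>, which serves the entries
    outside the 2 by 2 block.\<close>
  have "v (of_int a - 1) < \<epsilon>" "v (of_int e - 1) < \<epsilon>" "0 < \<epsilon>"
    using *[OF assms(2)] *[OF assms(5)] *[of 0] by simp_all
  then show ?thesis
    using assms(1) R[of 0] R[of 1] R *[OF assms(3)] *[OF assms(4)]
    by (auto simp: SL_eps_mats_def SL_mats_def blk_closed det_blk) (auto simp: blk_def)
qed

text \<open>The translation part combines \<open>xh $ 0\<close> and \<open>xh $ 1\<close> with
  coefficients divisible by \<open>M\<close>. These coordinates may have value above 1, so
  \<open>M\<close> has to compensate for their size.\<close>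

lemma congruence_group_SA_eps:
  assumes "v (of_int M) < \<epsilon>"
    and "v (of_int M) * v (xh $ 0) \<le> 1" "v (of_int M) * v (xh $ 1) \<le> 1"
  shows "congruence_group M \<subseteq> SA_eps v d (int_ring v) \<epsilon>"
proof
  fix f assume "f \<in> congruence_group M"
  then obtain a b c e where f: "f = aff a b c e" and 1: "a * e - b * c = 1"
    and 2: "M dvd a - 1" "M dvd b" "M dvd c" "M dvd e - 1"
    by (auto simp: congruence_group_def)
  have "range of_int \<subseteq> int_ring v"
    using val_of_int_le_1 by (auto simp: int_ring_def)
  with blk_SL_eps[OF 1 2 assms(1)] have "blk a b c e \<in> SL_eps_mats v d (int_ring v) \<epsilon>" .
  moreover have *: "v (- of_int z * xh $ i) \<le> 1" if "M dvd z" "v (of_int M) * v (xh $ i) \<le> 1" for z i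
    using mult_right_mono[OF val_of_int_dvd[OF that(1)] val_nonneg[of "xh $ i"]] that(2)
    by (simp add: val_mult)
  have "v (xh $ 0 - (of_int a * xh $ 0 + of_int b * xh $ 1)) \<le> 1"
    "v (xh $ 1 - (of_int c * xh $ 0 + of_int e * xh $ 1)) \<le> 1"
    using val_ultra[of "- of_int (a - 1) * xh $ 0" "- of_int b * xh $ 1"]
      val_ultra[of "- of_int c * xh $ 0" "- of_int (e - 1) * xh $ 1"]
      *[OF 2(1) assms(2)] *[OF 2(2) assms(3)] *[OF 2(3) assms(2)] *[OF 2(4) assms(3)]
    by (simp_all add: algebra_simps)
  then have "xh - blk a b c e *\<^sub>v xh \<in> vecs_over d (int_ring v)"
    using xh_closed by (auto simp: vecs_over_def blk_mult_vec int_ring_def)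
  ultimately show "f \<in> SA_eps v d (int_ring v) \<epsilon>"
    unfolding f SA_eps_def aff_def by blast
qed

lemma congruence_group_SL_eps:
  assumes "v (of_int M) < \<epsilon>" "xh $ 0 = 0" "xh $ 1 = 0"
  shows "congruence_group M \<subseteq> SL_eps v d \<int> \<epsilon>"
proof
  fix f assume "f \<in> congruence_group M"
  then obtain a b c e where f: "f = aff a b c e" and 1: "a * e - b * c = 1"
    and 2: "M dvd a - 1" "M dvd b" "M dvd c" "M dvd e - 1"
    by (auto simp: congruence_group_def)
  have "range of_int \<subseteq> (\<int> :: 'a set)" by auto
  with blk_SL_eps[OF 1 2 assms(1)] have "blk a b c e \<in> SL_eps_mats v d \<int> \<epsilon>" .
  moreover have "xh - blk a b c e *\<^sub>v xh = 0\<^sub>v d"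
    using assms(2,3) xh_closed by (intro eq_vecI) (auto simp: blk_mult_vec)
  ultimately show "f \<in> SL_eps v d \<int> \<epsilon>"
    unfolding f SL_eps_def aff_def by auto
qed

text \<open>In the first two coordinates \<open>f y - y\<close> is the block minus the identity, all
  of whose entries are divisible by \<open>M\<close>, applied to \<open>y - xh\<close>. So the
  displacement is at most \<open>v (of_int M)\<close> times the distance to the axis.\<close>

lemma congruence_group_displacement:
  assumes "f \<in> congruence_group M" "y \<in> carrier_vec d"
    and "v (of_int M) * v (y $ 0 - xh $ 0) < r" "v (of_int M) * v (y $ 1 - xh $ 1) < r"
  shows "vnorm v (f y - y) < r"
proof -
  obtain a b c e where f: "f = aff a b c e"
    and 2: "M dvd a - 1" "M dvd b" "M dvd c" "M dvd e - 1"
    using assms(1) by (auto simp: congruence_group_def)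
  have r: "r > 0"
    using assms(3) val_nonneg[of "of_int M"] val_nonneg[of "y $ 0 - xh $ 0"]
    by (meson mult_nonneg_nonneg order_le_less_trans)
  have *: "v (of_int z * (y $ i - xh $ i)) < r"
    if "M dvd z" "v (of_int M) * v (y $ i - xh $ i) < r" for z i
    using mult_right_mono[OF val_of_int_dvd[OF that(1)] val_nonneg[of "y $ i - xh $ i"]] that(2)
    by (simp add: val_mult)
  have "aff a b c e y $ 0 - y $ 0 =
      of_int (a - 1) * (y $ 0 - xh $ 0) + of_int b * (y $ 1 - xh $ 1)"
    "aff a b c e y $ 1 - y $ 1 =
      of_int c * (y $ 0 - xh $ 0) + of_int (e - 1) * (y $ 1 - xh $ 1)"
    using assms(2) dim_ge by (simp_all add: aff_apply algebra_simps)
  then have "v (aff a b c e y $ 0 - y $ 0) < r" "v (aff a b c e y $ 1 - y $ 1) < r"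
    using val_ultra[of "of_int (a - 1) * (y $ 0 - xh $ 0)" "of_int b * (y $ 1 - xh $ 1)"]
      val_ultra[of "of_int c * (y $ 0 - xh $ 0)" "of_int (e - 1) * (y $ 1 - xh $ 1)"]
      *[OF 2(1) assms(3)] *[OF 2(2) assms(4)] *[OF 2(3) assms(3)] *[OF 2(4) assms(4)]
    by simp_all
  \<comment> \<open>The other coordinates do not move, and there the strict bound is just
    \<open>r > 0\<close>.\<close>
  moreover have "aff a b c e y $ i - y $ i = 0" if "i \<ge> 2" "i < d" for i
    using assms(2) that by (simp add: aff_apply)
  moreover have "i = 0 \<or> i = 1 \<or> i \<ge> 2" for i :: nat by linarith
  ultimately have "v (aff a b c e y $ i - y $ i) < r" if "i < d" for i
    using that r by (metis val_0)
  then show ?thesis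
    unfolding f using dim_ge assms(2) by (subst vnorm_less_iff[of _ d]) (auto simp: aff_closed)
qed

end

section \<open>Choice of the level \<open>M\<close> and invariance of the balls\<close>

theorem theorem4p9:
  fixes v :: "'a::field_char_0 \<Rightarrow> real"
    and n :: nat
    and xhat x :: "'a vec"
    and r \<epsilon> :: real
  assumes "nonarch_valuation v"
    and "ring_char (residue_field v) > 0"
    and "n \<ge> 2"
    and "xhat \<in> carrier_vec n"
    and "x \<in> carrier_vec n"
    and "vec_first x 2 \<noteq> vec_first xhat 2"
    and "0 < r"
    and "r < vnorm v (vec_first x 2 - vec_first xhat 2)"
    and "0 < \<epsilon>"
    and "\<epsilon> \<le> 1"
  shows "\<exists>F'. free_subgroup_of_infinite_rank F' (BijGroup (carrier_vec n)) \<and>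
    F' \<subseteq> SA_eps v n (int_ring v) \<epsilon> \<and>
    acts_without_fixed_points F' (carrier_vec n)
      (carrier_vec n - (\<lambda>w. vec_first xhat 2 @\<^sub>v w) ` carrier_vec (n - 2)) \<and>
    acts_without_fixed_points F' (carrier_vec n) (vcball v x r) \<and>
    acts_without_fixed_points F' (carrier_vec n) (vball v x r) \<and>
    acts_without_fixed_points F' (carrier_vec n) (vsphere v x r) \<and>
    (vec_first xhat 2 \<in> vecs_over 2 \<int> \<longrightarrow> F' \<subseteq> SA n \<int>) \<and>
    (vec_first xhat 2 = 0\<^sub>v 2 \<longrightarrow> F' \<subseteq> SL_eps v n \<int> \<epsilon>)"
proof -
  interpret nonarch_valuation v by fact
  interpret valued_affine_action v n xhat
    using assms(3,4) by unfold_locales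
  define R where "R = vnorm v (vec_first x 2 - vec_first xhat 2)"
  have less_2: "(\<forall>i<2. P i) \<longleftrightarrow> P 0 \<and> P 1" for P :: "nat \<Rightarrow> bool"
    by (auto simp: less_2_cases_iff)
  have R_le: "R \<le> s \<longleftrightarrow> v (x $ 0 - xhat $ 0) \<le> s \<and> v (x $ 1 - xhat $ 1) \<le> s" for s
    unfolding R_def
    by (subst vnorm_le_iff[of _ 2]) (use assms(3-5) in \<open>auto simp: less_2 vec_first_def\<close>)
  obtain m where m: "m > 0" "v (of_nat m) < 1"
    using ring_char_residue_field_pos assms(2) by blast
  \<comment> \<open>\<open>C\<close> bounds the first two coordinates of \<open>xhat\<close> and, as
    \<open>r < R\<close>, also the distance to the axis from every point of the ball.\<close>
  define C where "C = 1 + R + v (xhat $ 0) + v (xhat $ 1)"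
  have C: "C > 0" "R < C" "v (xhat $ 0) \<le> C" "v (xhat $ 1) \<le> C"
    using val_nonneg[of "xhat $ 0"] val_nonneg[of "xhat $ 1"] assms(7,8)
    by (auto simp: C_def R_def)
  \<comment> \<open>The three bounds make the matrices close to the identity, the translations
    integral and the displacements smaller than \<open>r\<close>.\<close>
  define \<delta> where "\<delta> = min \<epsilon> (min (1 / C) (r / C))"
  have "\<delta> > 0" using C assms(7,9) by (simp add: \<delta>_def)
  then obtain k where k: "v (of_nat m) ^ k < \<delta>"
    using real_arch_pow_inv m(2) by blast
  define M where "M = int m ^ k"
  have "M > 0" using m by (simp add: M_def)
  have vM: "v (of_int M) < \<delta>" using k by (simp add: M_def val_power)
  have vM_eps: "v (of_int M) < \<epsilon>" using vM by (simp add: \<delta>_def)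
  have "v (of_int M) < 1 / C" "v (of_int M) < r / C"
    using vM by (simp_all add: \<delta>_def)
  then have vM_C: "v (of_int M) * C < 1" "v (of_int M) * C < r"
    using C(1) by (simp_all add: field_simps)
  have vM_mult: "v (of_int M) * s < 1" "v (of_int M) * s < r" if "s \<le> C" for s
    using mult_left_mono[OF that val_nonneg[of "of_int M"]] vM_C by simp_all
  have off_axis: "y \<in> carrier_vec n - axis"
    and invariant: "f \<in> congruence_group M \<Longrightarrow> f y \<in> carrier_vec n \<and> vnorm v (f y - y) < r"
    if y: "y \<in> vcball v x r" for y f
  proof -
    have yn: "y \<in> carrier_vec n" and le: "vnorm v (y - x) \<le> r"
      using y assms(5) by (auto simp: vcball_def)
    then have le_i: "v (y $ i - x $ i) \<le> r" if "i < n" for i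
      using vnorm_le_iff[of "y - x" n r] assms(3,5) that by simp
    \<comment> \<open>A point of the ball on the axis would give \<open>R \<le> r\<close>.\<close>
    show "y \<in> carrier_vec n - axis"
      using le_i[of 0] le_i[of 1] R_le[of r] yn assms(3,8)
      by (auto simp: axis_def R_def val_diff_swap)
    assume f: "f \<in> congruence_group M"
    have "v (y $ i - xhat $ i) \<le> C" if "i < 2" for i
    proof -
      have "v (x $ i - xhat $ i) \<le> R" using R_le[of R] less_2_cases[OF that] by auto
      moreover have "v (y $ i - x $ i) \<le> R"
        using le_i[of i] that assms(3,8) by (simp add: R_def)
      ultimately show ?thesis
        using val_ultra[of "y $ i - x $ i" "x $ i - xhat $ i"] C(2) by simp
    qed
    then have "vnorm v (f y - y) < r"
      by (intro congruence_group_displacement[OF f yn] vM_mult(2)) simp_all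
    then show "f y \<in> carrier_vec n \<and> vnorm v (f y - y) < r"
      using f yn aff_closed by (auto simp: congruence_group_def)
  qed
  have sub: "vball v x r \<subseteq> vcball v x r" "vsphere v x r \<subseteq> vcball v x r"
    by (auto simp: vball_def vsphere_def vcball_def)
  have perturb: "f y \<in> vcball v x r" "y \<in> vball v x r \<Longrightarrow> f y \<in> vball v x r"
    "y \<in> vsphere v x r \<Longrightarrow> f y \<in> vsphere v x r"
    if "f \<in> congruence_group M" "y \<in> vcball v x r" for f y
    using vball_perturb[of x n y "f y" r] invariant[OF that(2,1)] off_axis[OF that(2)] assms(3,5) that(2)
    by auto
  have "acts_without_fixed_points (hyp_group M) (carrier_vec n) (vcball v x r)"
    using off_axis perturb(1) by (intro hyp_group_acts \<open>M > 0\<close>) auto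
  moreover have "acts_without_fixed_points (hyp_group M) (carrier_vec n) (vball v x r)"
    using off_axis perturb(2) sub(1) by (intro hyp_group_acts \<open>M > 0\<close>) blast+
  moreover have "acts_without_fixed_points (hyp_group M) (carrier_vec n) (vsphere v x r)"
    using off_axis perturb(3) sub(2) by (intro hyp_group_acts \<open>M > 0\<close>) blast+
  moreover have "acts_without_fixed_points (hyp_group M) (carrier_vec n) (carrier_vec n - axis)"
    using congruence_group_off_axis by (intro hyp_group_acts \<open>M > 0\<close>) auto
  moreover have "hyp_group M \<subseteq> SA_eps v n (int_ring v) \<epsilon>"
    using hyp_group_congruence congruence_group_SA_eps[OF vM_eps] vM_mult(1) C(3,4)
    by (meson less_imp_le order_trans)
  moreover have "hyp_group M \<subseteq> SA n \<int>" if "vec_first xhat 2 \<in> vecs_over 2 \<int>"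
  proof -
    have "xhat $ 0 \<in> \<int>" "xhat $ 1 \<in> \<int>"
      using that by (simp_all add: vecs_over_def vec_first_def less_2)
    then have "congruence_group M \<subseteq> SA n \<int>"
      unfolding congruence_group_def using aff_in_SA by blast
    then show ?thesis
      using hyp_group_congruence by blast
  qed
  moreover have "hyp_group M \<subseteq> SL_eps v n \<int> \<epsilon>" if "vec_first xhat 2 = 0\<^sub>v 2"
  proof -
    have "vec_first xhat 2 $ 0 = 0" "vec_first xhat 2 $ 1 = 0"
      unfolding that by simp_all
    then have "xhat $ 0 = 0" "xhat $ 1 = 0"
      by (simp_all add: vec_first_def)
    then show ?thesis
      using hyp_group_congruence congruence_group_SL_eps[OF vM_eps] by blast
  qed
  ultimately show ?thesis
    using free_hyp_group[OF \<open>M > 0\<close>] unfolding axis_eq by blast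
qed

end
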